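(* Let $K$ be a field with $\mathrm{char}(K)\neq2,3$ and let $g_1,g_2$ be binary cubic forms over $K$ with $\mathrm{disc}(g_1)=\mathrm{disc}(g_2)\neq0$. Let $B_{g_1,g_2}(X_1,Y_1,X_2,Y_2)=g_2(X_2,Y_2)G_1(X_1,Y_1)-G_2(X_2,Y_2)g_1(X_1,Y_1)$, where $G_i$ is the cubic covariant of $g_i$. Then the following are equivalent: (1) $B_{g_1,g_2}$ has a bilinear factor (a factor bihomogeneous of degree $1$ in $(X_1,Y_1)$ and degree $1$ in $(X_2,Y_2)$) in $K[X_1,Y_1,X_2,Y_2]$; (2) $g_1$ and $g_2$ are $\mathrm{SL}(2,K)$-equivalent. More precisely, for $M=\begin{pmatrix}r&s\\t&u\end{pmatrix}\in\mathrm{SL}(2,K)$, $B_{g_1,g_2}$ has the factor $-sX_1X_2+rX_1Y_2-uY_1X_2+tY_1Y_2$ (up to scaling) if and only if $g_1=g_2^M$.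
   Context: For $g=aX^3+bX^2Y+cXY^2+dY^3$, $\mathrm{disc}(g)=b^2c^2-4ac^3-4b^3d-27a^2d^2+18abcd$ and the cubic covariant is $G(X,Y)=(2b^3+27a^2d-9abc)X^3+3(b^2c+9abd-6ac^2)X^2Y-3(bc^2+9acd-6b^2d)XY^2-(2c^3+27ad^2-9bcd)Y^3$. The action of $M=\begin{pmatrix}r&s\\t&u\end{pmatrix}\in\mathrm{GL}(2,K)$ is $g^M(X,Y)=\det(M)^{-1}g(rX+tY,sX+uY)$; $g_1,g_2$ are $\mathrm{SL}(2,K)$-equivalent if $g_2=g_1^M$ for some $M\in\mathrm{SL}(2,K)$.
   Formalization: In the "more precisely" clause, "g_1 = g_2^M" is replaced by "g_1 = g_2^M or g_1 = g_2^{-M}": M and -M give the same factor up to scaling but g_2^{-M} = -g_2^M, so the literal clause fails (e.g. g_1 = g_2, M = -I). *)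

theory Defs
  imports "HOL-Analysis.Analysis" "HOL-Computational_Algebra.Computational_Algebra"
begin

text \<open>
  The ring \<open>K[X, Y]\<close> is \<open>K[X][Y]\<close>, so the coefficient of \<open>X ^ i * Y ^ j\<close> in \<open>p\<close> is
  \<open>coeff (coeff p j) i\<close>; likewise \<open>K[X1, Y1, X2, Y2]\<close> is \<open>K[X1][Y1][X2][Y2]\<close>.
\<close>

type_synonym 'a poly2 = "'a poly poly"
type_synonym 'a poly4 = "'a poly poly poly poly"

definition Const_2 :: "'a::comm_ring_1 \<Rightarrow> 'a poly2" where
  "Const_2 c = [:[:c:]:]"

definition Var_X :: "'a::comm_ring_1 poly2" where
  "Var_X = [:[:0, 1:]:]"

definition Var_Y :: "'a::comm_ring_1 poly2" where
  "Var_Y = [:0, 1:]"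

definition Const_4 :: "'a::comm_ring_1 \<Rightarrow> 'a poly4" where
  "Const_4 c = [:[:[:[:c:]:]:]:]"

definition Var_X1 :: "'a::comm_ring_1 poly4" where
  "Var_X1 = [:[:[:[:0, 1:]:]:]:]"

definition Var_Y1 :: "'a::comm_ring_1 poly4" where
  "Var_Y1 = [:[:[:0, 1:]:]:]"

definition Var_X2 :: "'a::comm_ring_1 poly4" where
  "Var_X2 = [:[:0, 1:]:]"

definition Var_Y2 :: "'a::comm_ring_1 poly4" where
  "Var_Y2 = [:0, 1:]"

text \<open>\<open>subst2 h g P Q\<close> is \<open>g(P, Q)\<close>, where \<open>h\<close> embeds the coefficients in the target ring.\<close>

definition subst2 ::
  "('a::comm_ring_1 \<Rightarrow> 'b::comm_ring_1) \<Rightarrow> 'a poly2 \<Rightarrow> 'b \<Rightarrow> 'b \<Rightarrow> 'b" where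
  "subst2 h g P Q = poly (map_poly (\<lambda>q. poly (map_poly h q) P) g) Q"

definition cubic_form :: "'a::comm_ring_1 \<Rightarrow> 'a \<Rightarrow> 'a \<Rightarrow> 'a \<Rightarrow> 'a poly2" where
  "cubic_form a b c d =
     Const_2 a * Var_X ^ 3 + Const_2 b * Var_X ^ 2 * Var_Y
     + Const_2 c * Var_X * Var_Y ^ 2 + Const_2 d * Var_Y ^ 3"

definition binary_cubic_form :: "'a::comm_ring_1 poly2 \<Rightarrow> bool" where
  "binary_cubic_form g \<longleftrightarrow> (\<exists>a b c d. g = cubic_form a b c d)"

text \<open>The following two are meaningful only when \<open>g\<close> is a binary cubic form.\<close>

definition cubic_disc :: "'a::comm_ring_1 poly2 \<Rightarrow> 'a" where
  "cubic_disc g =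
    (let a = coeff (coeff g 0) 3; b = coeff (coeff g 1) 2;
         c = coeff (coeff g 2) 1; d = coeff (coeff g 3) 0
     in b^2 * c^2 - 4 * a * c^3 - 4 * b^3 * d - 27 * a^2 * d^2 + 18 * a * b * c * d)"

definition cubic_covariant :: "'a::comm_ring_1 poly2 \<Rightarrow> 'a poly2" where
  "cubic_covariant g =
    (let a = coeff (coeff g 0) 3; b = coeff (coeff g 1) 2;
         c = coeff (coeff g 2) 1; d = coeff (coeff g 3) 0
     in cubic_form
          (2 * b^3 + 27 * a^2 * d - 9 * a * b * c)
          (3 * (b^2 * c + 9 * a * b * d - 6 * a * c^2))
          (- 3 * (b * c^2 + 9 * a * c * d - 6 * b^2 * d))
          (- (2 * c^3 + 27 * a * d^2 - 9 * b * c * d)))"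

text \<open>\<open>M $ i $ j\<close> is the entry in row \<open>i\<close> and column \<open>j\<close>.\<close>

definition act :: "'a::field poly2 \<Rightarrow> 'a^2^2 \<Rightarrow> 'a poly2" where
  "act g M =
     Const_2 (inverse (det M)) *
     subst2 Const_2 g
       (Const_2 (M $ 1 $ 1) * Var_X + Const_2 (M $ 2 $ 1) * Var_Y)
       (Const_2 (M $ 1 $ 2) * Var_X + Const_2 (M $ 2 $ 2) * Var_Y)"

definition SL2_equivalent :: "'a::field poly2 \<Rightarrow> 'a poly2 \<Rightarrow> bool" where
  "SL2_equivalent g1 g2 \<longleftrightarrow> (\<exists>M. det M = 1 \<and> g2 = act g1 M)"

definition B_poly :: "'a::comm_ring_1 poly2 \<Rightarrow> 'a poly2 \<Rightarrow> 'a poly4" where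
  "B_poly g1 g2 =
     subst2 Const_4 g2 Var_X2 Var_Y2 * subst2 Const_4 (cubic_covariant g1) Var_X1 Var_Y1
     - subst2 Const_4 (cubic_covariant g2) Var_X2 Var_Y2 * subst2 Const_4 g1 Var_X1 Var_Y1"

definition bihomogeneous :: "nat \<Rightarrow> nat \<Rightarrow> 'a::comm_ring_1 poly4 \<Rightarrow> bool" where
  "bihomogeneous m n p \<longleftrightarrow>
     (\<forall>i j k l. coeff (coeff (coeff (coeff p l) k) j) i \<noteq> 0 \<longrightarrow> i + j = m \<and> k + l = n)"

definition has_bilinear_factor :: "'a::comm_ring_1 poly4 \<Rightarrow> bool" where
  "has_bilinear_factor B \<longleftrightarrow> (\<exists>p. p \<noteq> 0 \<and> bihomogeneous 1 1 p \<and> p dvd B)"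

definition bilinear_of :: "'a::comm_ring_1^2^2 \<Rightarrow> 'a poly4" where
  "bilinear_of M =
     - (Const_4 (M $ 1 $ 2) * Var_X1 * Var_X2) + Const_4 (M $ 1 $ 1) * Var_X1 * Var_Y2
     - Const_4 (M $ 2 $ 2) * Var_Y1 * Var_X2 + Const_4 (M $ 2 $ 1) * Var_Y1 * Var_Y2"

text \<open>
  The next two facts show that the matrix of a bilinear factor is determined only up to sign:
  \<open>M\<close> and \<open>- M\<close> give proportional bilinear forms, although they act differently on cubic forms.
\<close>

lemma bilinear_of_uminus:
  fixes M :: "'a::comm_ring_1^2^2"
  shows "bilinear_of (- M) = - bilinear_of M"
proof -
  have "Const_4 (- x) = - Const_4 x" for x :: 'a
    by (simp add: Const_4_def)
  then show ?thesis
    by (simp add: bilinear_of_def)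
qed

lemma subst2_Const_2_cubic_form:
  "subst2 Const_2 (cubic_form a b c d) P Q =
     Const_2 a * P ^ 3 + Const_2 b * P ^ 2 * Q + Const_2 c * P * Q ^ 2 + Const_2 d * Q ^ 3"
proof -
  have "cubic_form a b c d = [:[:0, 0, 0, a:], [:0, 0, b:], [:0, c:], [:d:]:]"
    by (simp add: cubic_form_def Const_2_def Var_X_def Var_Y_def power2_eq_square power3_eq_cube)
  then show ?thesis
    by (simp add: subst2_def map_poly_pCons Const_2_def power2_eq_square power3_eq_cube
        algebra_simps)
qed

lemma act_uminus:
  fixes g :: "'a::field poly2"
  assumes "binary_cubic_form g"
  shows "act g (- M) = - act g M"
proof -
  obtain a b c d where g: "g = cubic_form a b c d"
    using assms by (auto simp: binary_cubic_form_def)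
  have det: "det (- M) = det M"
    by (simp add: det_2)
  have neg: "Const_2 (- x) = - Const_2 x" for x :: 'a
    by (simp add: Const_2_def)
  have lin: "Const_2 ((- M) $ i $ k) * Var_X + Const_2 ((- M) $ j $ k) * Var_Y
      = - (Const_2 (M $ i $ k) * Var_X + Const_2 (M $ j $ k) * Var_Y)" for i j k
    by (simp add: neg)
  show ?thesis
    unfolding act_def g det lin subst2_Const_2_cubic_form
    by (simp add: power2_eq_square power3_eq_cube algebra_simps)
qed

end

theory Submission
  imports Defs
begin

text \<open>
  Write \<open>h\<close> for \<open>g2(rX + tY, sX + uY)\<close> and \<open>H\<close> for its covariant. If the bilinear form
  \<open>L\<close> with matrix \<open>N\<close> divides \<open>B\<close>, then substituting \<open>(X2, Y2) = (rX1 + tY1, sX1 + uY1)\<close>, a zero of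
  \<open>L\<close>, gives \<open>det N ^ 3 * h * G1 = H * g1\<close>. Because the discriminant of \<open>h\<close> is nonzero, \<open>h\<close> and \<open>H\<close>
  are coprime, so \<open>g1 = l * h\<close> and \<open>G1 = l ^ 3 * H\<close>, whence \<open>l ^ 2 * det N ^ 3 = 1\<close>. In particular
  \<open>det N\<close> is a square, \<open>l * det N * N\<close> lies in \<open>SL2\<close>, and this matrix maps \<open>g2\<close> to \<open>g1\<close>. If \<open>N\<close> is
  singular, \<open>L\<close> splits into linear forms, and a zero of the one in \<open>(X2, Y2)\<close> would make \<open>g1\<close>
  proportional to \<open>G1\<close>. Conversely, if \<open>g1 = h\<close> then \<open>B\<close> is an alternating expression in the
  points \<open>(X2, Y2)\<close> and \<open>(rX1 + tY1, sX1 + uY1)\<close>, hence divisible by their determinant \<open>L\<close>.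
\<close>

section \<open>Invariants and covariants of a cubic in terms of its coefficients\<close>

definition cdisc :: "'a::comm_ring_1 \<Rightarrow> 'a \<Rightarrow> 'a \<Rightarrow> 'a \<Rightarrow> 'a" where
  "cdisc a b c d =
     b^2 * c^2 - 4 * a * c^3 - 4 * b^3 * d - 27 * a^2 * d^2 + 18 * a * b * c * d"

definition cov0 :: "'a::comm_ring_1 \<Rightarrow> 'a \<Rightarrow> 'a \<Rightarrow> 'a \<Rightarrow> 'a" where
  "cov0 a b c d = 2 * b^3 + 27 * a^2 * d - 9 * a * b * c"

definition cov1 :: "'a::comm_ring_1 \<Rightarrow> 'a \<Rightarrow> 'a \<Rightarrow> 'a \<Rightarrow> 'a" where
  "cov1 a b c d = 3 * (b^2 * c + 9 * a * b * d - 6 * a * c^2)"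

definition cov2 :: "'a::comm_ring_1 \<Rightarrow> 'a \<Rightarrow> 'a \<Rightarrow> 'a \<Rightarrow> 'a" where
  "cov2 a b c d = - 3 * (b * c^2 + 9 * a * c * d - 6 * b^2 * d)"

definition cov3 :: "'a::comm_ring_1 \<Rightarrow> 'a \<Rightarrow> 'a \<Rightarrow> 'a \<Rightarrow> 'a" where
  "cov3 a b c d = - (2 * c^3 + 27 * a * d^2 - 9 * b * c * d)"

lemmas cov_defs = cov0_def cov1_def cov2_def cov3_def

text \<open>The ring is arbitrary because the expression is evaluated on scalars, on polynomials in
  \<open>X1\<close>, and on the variables of \<open>K[X, Y]\<close> and
  \<open>K[X1, Y1, X2, Y2]\<close>.\<close>

definition cubic_at :: "'a::comm_ring_1 \<Rightarrow> 'a \<Rightarrow> 'a \<Rightarrow> 'a \<Rightarrow> 'a \<Rightarrow> 'a \<Rightarrow> 'a" where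
  "cubic_at a b c d x y = a * x^3 + b * x^2 * y + c * x * y^2 + d * y^3"

text \<open>Together with \<open>hess1\<close> and \<open>hess2\<close>, the coefficients of the
  Hessian covariant: the determinant of second partial derivatives is -4 times this quadratic
  form.\<close>

definition hess0 :: "'a::comm_ring_1 \<Rightarrow> 'a \<Rightarrow> 'a \<Rightarrow> 'a \<Rightarrow> 'a" where
  "hess0 a b c d = b^2 - 3 * a * c"

definition hess1 :: "'a::comm_ring_1 \<Rightarrow> 'a \<Rightarrow> 'a \<Rightarrow> 'a \<Rightarrow> 'a" where
  "hess1 a b c d = b * c - 9 * a * d"

definition hess2 :: "'a::comm_ring_1 \<Rightarrow> 'a \<Rightarrow> 'a \<Rightarrow> 'a \<Rightarrow> 'a" where
  "hess2 a b c d = c^2 - 3 * b * d"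

lemmas hess_defs = hess0_def hess1_def hess2_def

text \<open>
  The numbers \<open>tr0\<close>, \<open>tr1\<close>, \<open>tr2\<close>, \<open>tr3\<close> are the coefficients of \<open>g(rX + tY, sX + uY)\<close>.
\<close>

definition tr0 :: "'a::comm_ring_1 \<Rightarrow> 'a \<Rightarrow> 'a \<Rightarrow> 'a \<Rightarrow> 'a \<Rightarrow> 'a \<Rightarrow> 'a \<Rightarrow> 'a \<Rightarrow> 'a" where
  "tr0 a b c d r s t u = a * r^3 + b * r^2 * s + c * r * s^2 + d * s^3"

definition tr1 :: "'a::comm_ring_1 \<Rightarrow> 'a \<Rightarrow> 'a \<Rightarrow> 'a \<Rightarrow> 'a \<Rightarrow> 'a \<Rightarrow> 'a \<Rightarrow> 'a \<Rightarrow> 'a" where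
  "tr1 a b c d r s t u =
     3 * a * r^2 * t + b * (r^2 * u + 2 * r * s * t) + c * (2 * r * s * u + s^2 * t)
     + 3 * d * s^2 * u"

definition tr2 :: "'a::comm_ring_1 \<Rightarrow> 'a \<Rightarrow> 'a \<Rightarrow> 'a \<Rightarrow> 'a \<Rightarrow> 'a \<Rightarrow> 'a \<Rightarrow> 'a \<Rightarrow> 'a" where
  "tr2 a b c d r s t u =
     3 * a * r * t^2 + b * (s * t^2 + 2 * r * t * u) + c * (2 * s * t * u + r * u^2)
     + 3 * d * s * u^2"

definition tr3 :: "'a::comm_ring_1 \<Rightarrow> 'a \<Rightarrow> 'a \<Rightarrow> 'a \<Rightarrow> 'a \<Rightarrow> 'a \<Rightarrow> 'a \<Rightarrow> 'a \<Rightarrow> 'a" where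
  "tr3 a b c d r s t u = a * t^3 + b * t^2 * u + c * t * u^2 + d * u^3"

lemmas tr_defs = tr0_def tr1_def tr2_def tr3_def

section \<open>Behaviour under linear substitution\<close>

lemma cubic_at_tr:
  "cubic_at (tr0 a b c d r s t u) (tr1 a b c d r s t u) (tr2 a b c d r s t u)
     (tr3 a b c d r s t u) x y = cubic_at a b c d (r * x + t * y) (s * x + u * y)"
  by (simp add: cubic_at_def tr_defs algebra_simps eval_nat_numeral)

text \<open>Substituting by a matrix and then by its adjugate scales both variables by the
  determinant, hence a cubic form by its cube.\<close>

lemma tr_adjugate:
  fixes a b c d r s t u :: "'a::comm_ring_1"
  defines "a' \<equiv> tr0 a b c d r s t u" and "b' \<equiv> tr1 a b c d r s t u"
    and "c' \<equiv> tr2 a b c d r s t u" and "d' \<equiv> tr3 a b c d r s t u"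
  assumes det: "r * u - s * t = 1"
  shows "tr0 a' b' c' d' u (- s) (- t) r = a" "tr1 a' b' c' d' u (- s) (- t) r = b"
    and "tr2 a' b' c' d' u (- s) (- t) r = c" "tr3 a' b' c' d' u (- s) (- t) r = d"
proof -
  have "tr0 a' b' c' d' u (- s) (- t) r = (r * u - s * t)^3 * a"
    "tr1 a' b' c' d' u (- s) (- t) r = (r * u - s * t)^3 * b"
    "tr2 a' b' c' d' u (- s) (- t) r = (r * u - s * t)^3 * c"
    "tr3 a' b' c' d' u (- s) (- t) r = (r * u - s * t)^3 * d"
    unfolding a'_def b'_def c'_def d'_def
    by (simp_all add: tr_defs algebra_simps eval_nat_numeral)
  then show "tr0 a' b' c' d' u (- s) (- t) r = a" "tr1 a' b' c' d' u (- s) (- t) r = b"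
    "tr2 a' b' c' d' u (- s) (- t) r = c" "tr3 a' b' c' d' u (- s) (- t) r = d"
    by (simp_all add: det)
qed

text \<open>The Hessian is a covariant of weight 2; \<open>cdisc_tr\<close> and
  \<open>cov_tr\<close> inherit their transformation laws from it.\<close>

lemma hess_tr:
  fixes a b c d r s t u :: "'a::comm_ring_1"
  defines "a' \<equiv> tr0 a b c d r s t u" and "b' \<equiv> tr1 a b c d r s t u"
    and "c' \<equiv> tr2 a b c d r s t u" and "d' \<equiv> tr3 a b c d r s t u"
    and "A \<equiv> hess0 a b c d" and "B \<equiv> hess1 a b c d" and "C \<equiv> hess2 a b c d"
  shows "hess0 a' b' c' d' = (r * u - s * t)^2 * (A * r^2 + B * r * s + C * s^2)"
    and "hess1 a' b' c' d' =
      (r * u - s * t)^2 * (2 * A * r * t + B * (r * u + s * t) + 2 * C * s * u)"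
    and "hess2 a' b' c' d' = (r * u - s * t)^2 * (A * t^2 + B * t * u + C * u^2)"
  unfolding assms by (simp_all add: hess_defs tr_defs algebra_simps eval_nat_numeral)

text \<open>As a binary quadratic form, the Hessian has discriminant -3 times that of the
  cubic.\<close>

lemma three_cdisc_hess: "3 * cdisc a b c d = 4 * hess0 a b c d * hess2 a b c d - (hess1 a b c d)^2"
  by (simp add: cdisc_def hess_defs algebra_simps eval_nat_numeral)

text \<open>The weight 6 is 4 from the factors in \<open>hess_tr\<close> plus 2 from the
  discriminant of a quadratic form; the factor 3 of \<open>three_cdisc_hess\<close> is then
  cancelled.\<close>

lemma cdisc_tr:
  fixes a b c d r s t u :: "'a::idom"
  assumes "(3::'a) \<noteq> 0"
  shows "cdisc (tr0 a b c d r s t u) (tr1 a b c d r s t u) (tr2 a b c d r s t u)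
     (tr3 a b c d r s t u) = (r * u - s * t)^6 * cdisc a b c d"
proof -
  have quadratic: "4 * (A * r^2 + B * r * s + C * s^2) * (A * t^2 + B * t * u + C * u^2)
      - (2 * A * r * t + B * (r * u + s * t) + 2 * C * s * u)^2
      = (r * u - s * t)^2 * (4 * A * C - B^2)" for A B C :: 'a
    by (simp add: algebra_simps eval_nat_numeral)
  have "4 * (e^2 * x) * (e^2 * y) - (e^2 * z)^2 = e^4 * (4 * x * y - z^2)" for e x y z :: 'a
    by (simp add: algebra_simps eval_nat_numeral)
  then have "3 * cdisc (tr0 a b c d r s t u) (tr1 a b c d r s t u) (tr2 a b c d r s t u)
     (tr3 a b c d r s t u) = (r * u - s * t)^4 * ((r * u - s * t)^2 * (3 * cdisc a b c d))"
    unfolding three_cdisc_hess hess_tr by (simp only: quadratic)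
  also have "\<dots> = 3 * ((r * u - s * t)^6 * cdisc a b c d)"
    by (simp add: eval_nat_numeral)
  finally show ?thesis
    using assms by simp
qed

text \<open>The cubic covariant is the Jacobian \<open>H_X g_Y - H_Y g_X\<close> of the form and its
  Hessian.\<close>

lemma cov_jacobian:
  "cov0 a b c d = 2 * b * hess0 a b c d - 3 * a * hess1 a b c d"
  "cov1 a b c d = 4 * c * hess0 a b c d - b * hess1 a b c d - 6 * a * hess2 a b c d"
  "cov2 a b c d = 6 * d * hess0 a b c d + c * hess1 a b c d - 4 * b * hess2 a b c d"
  "cov3 a b c d = 3 * d * hess1 a b c d - 2 * c * hess2 a b c d"
  by (simp_all add: cov_defs hess_defs algebra_simps eval_nat_numeral)

text \<open>Of the weight 3, two come from the Hessian and one from the Jacobian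
  determinant.\<close>

lemma cov_tr:
  fixes a b c d r s t u :: "'a::comm_ring_1"
  defines "a' \<equiv> tr0 a b c d r s t u" and "b' \<equiv> tr1 a b c d r s t u"
    and "c' \<equiv> tr2 a b c d r s t u" and "d' \<equiv> tr3 a b c d r s t u"
    and "A \<equiv> cov0 a b c d" and "B \<equiv> cov1 a b c d" and "C \<equiv> cov2 a b c d" and "E \<equiv> cov3 a b c d"
  shows "cov0 a' b' c' d' = (r * u - s * t)^3 * tr0 A B C E r s t u"
    and "cov1 a' b' c' d' = (r * u - s * t)^3 * tr1 A B C E r s t u"
    and "cov2 a' b' c' d' = (r * u - s * t)^3 * tr2 A B C E r s t u"
    and "cov3 a' b' c' d' = (r * u - s * t)^3 * tr3 A B C E r s t u"
  unfolding assms cov_jacobian hess_tr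
  by (simp_all add: tr_defs algebra_simps eval_nat_numeral)

lemma cov_scale:
  "cov0 (l * a) (l * b) (l * c) (l * d) = l^3 * cov0 a b c d"
  "cov1 (l * a) (l * b) (l * c) (l * d) = l^3 * cov1 a b c d"
  "cov2 (l * a) (l * b) (l * c) (l * d) = l^3 * cov2 a b c d"
  "cov3 (l * a) (l * b) (l * c) (l * d) = l^3 * cov3 a b c d"
  by (simp_all add: cov_defs algebra_simps eval_nat_numeral)

lemma tr_scale:
  "tr0 a b c d (l * r) (l * s) (l * t) (l * u) = l^3 * tr0 a b c d r s t u"
  "tr1 a b c d (l * r) (l * s) (l * t) (l * u) = l^3 * tr1 a b c d r s t u"
  "tr2 a b c d (l * r) (l * s) (l * t) (l * u) = l^3 * tr2 a b c d r s t u"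
  "tr3 a b c d (l * r) (l * s) (l * t) (l * u) = l^3 * tr3 a b c d r s t u"
  by (simp_all add: tr_defs algebra_simps eval_nat_numeral)

section \<open>Coprimality of a cubic and its covariant\<close>

text \<open>Proportionality kills the 2x2 minors of the two coefficient rows. Combinations of these
  minors give the squares of the Hessian coefficients, and a cubic with zero Hessian has zero
  discriminant.\<close>

lemma cdisc_zero_if_cov_proportional:
  fixes a b c d :: "'a::idom"
  assumes two: "(2::'a) \<noteq> 0" and three: "(3::'a) \<noteq> 0"
    and e: "x * cov0 a b c d = y * a" "x * cov1 a b c d = y * b"
      "x * cov2 a b c d = y * c" "x * cov3 a b c d = y * d"
    and "x \<noteq> 0"
  shows "cdisc a b c d = 0"
proof -
  have minor: "p * z - q * w = 0" if "x * p = y * w" "x * q = y * z" for p q z w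
  proof -
    have "x * (p * z - q * w) = 0"
      using that by (simp add: right_diff_distrib mult.assoc[symmetric])
    then show ?thesis using \<open>x \<noteq> 0\<close> by simp
  qed
  have "2 * (hess0 a b c d)^2 = cov0 a b c d * b - cov1 a b c d * a"
    "2 * (hess2 a b c d)^2 = cov2 a b c d * d - cov3 a b c d * c"
    by (simp_all add: cov_defs hess_defs algebra_simps eval_nat_numeral)
  then have H: "hess0 a b c d = 0" "hess2 a b c d = 0"
    using minor[OF e(1,2)] minor[OF e(3,4)] two by simp_all
  have "2 * (hess1 a b c d)^2 - 2 * hess0 a b c d * hess2 a b c d
     = 3 * (cov0 a b c d * d - cov3 a b c d * a)"
    by (simp add: cov_defs hess_defs algebra_simps eval_nat_numeral)
  then have "hess1 a b c d = 0"
    using minor[OF e(1,4)] two H by simp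
  then show ?thesis
    using three_cdisc_hess[of a b c d] H three by simp
qed

text \<open>
  The hypotheses compare the coefficients in \<open>g * u = G * v\<close>. In the certificates below, the
  multipliers of \<open>f0\<close> to \<open>f6\<close> are consecutive terms of a linear recurrence with coefficients
  \<open>a, b, c, d\<close>, which eliminates \<open>u\<close>; they were found by solving a linear system.
\<close>

lemma cubic_syzygies_proportional:
  fixes a b c d :: "'a::idom"
  assumes "(2::'a) \<noteq> 0" and "cdisc a b c d \<noteq> 0"
    and e0: "a * u0 = cov0 a b c d * v0"
    and e1: "a * u1 + b * u0 = cov0 a b c d * v1 + cov1 a b c d * v0"
    and e2: "a * u2 + b * u1 + c * u0 =
      cov0 a b c d * v2 + cov1 a b c d * v1 + cov2 a b c d * v0"
    and e3: "a * u3 + b * u2 + c * u1 + d * u0 =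
      cov0 a b c d * v3 + cov1 a b c d * v2 + cov2 a b c d * v1 + cov3 a b c d * v0"
    and e4: "b * u3 + c * u2 + d * u1 =
      cov1 a b c d * v3 + cov2 a b c d * v2 + cov3 a b c d * v1"
    and e5: "c * u3 + d * u2 = cov2 a b c d * v3 + cov3 a b c d * v2"
    and e6: "d * u3 = cov3 a b c d * v3"
  shows "a * v1 = b * v0" "a * v2 = c * v0" "a * v3 = d * v0"
    and "b * v2 = c * v1" "b * v3 = d * v1" "c * v3 = d * v2"
proof -
  define f0 where "f0 = cov0 a b c d * v0 - a * u0"
  define f1 where "f1 = cov0 a b c d * v1 + cov1 a b c d * v0 - (a * u1 + b * u0)"
  define f2 where "f2 = cov0 a b c d * v2 + cov1 a b c d * v1 + cov2 a b c d * v0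
    - (a * u2 + b * u1 + c * u0)"
  define f3 where "f3 = cov0 a b c d * v3 + cov1 a b c d * v2 + cov2 a b c d * v1
    + cov3 a b c d * v0 - (a * u3 + b * u2 + c * u1 + d * u0)"
  define f4 where "f4 = cov1 a b c d * v3 + cov2 a b c d * v2 + cov3 a b c d * v1
    - (b * u3 + c * u2 + d * u1)"
  define f5 where "f5 = cov2 a b c d * v3 + cov3 a b c d * v2 - (c * u3 + d * u2)"
  define f6 where "f6 = cov3 a b c d * v3 - d * u3"
  note f_defs = f0_def f1_def f2_def f3_def f4_def f5_def f6_def
  have f_zero: "f0 = 0" "f1 = 0" "f2 = 0" "f3 = 0" "f4 = 0" "f5 = 0" "f6 = 0"
    using e0 e1 e2 e3 e4 e5 e6 by (simp_all add: f_defs)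
  \<comment> \<open>\<open>2 * (cdisc a b c d)^2\<close> is a common denominator for all six
    certificates.\<close>
  have cancel: "x = y" if "2 * (cdisc a b c d)^2 * (x - y) = 0" for x y
    using that assms(1,2) by simp
  have "2 * (cdisc a b c d)^2 * (a * v1 - b * v0) =
      (- 54*a^2*b*d^3 + 9*a^2*c^2*d^2 + 48*a*b^2*c*d^2 - 20*a*b*c^3*d + 2*a*c^5 - 16*b^4*d^2
          + 8*b^3*c^2*d - b^2*c^4) * f0
      + (27*a^3*d^3 - 27*a^2*b*c*d^2 + 7*a^2*c^3*d + 16*a*b^3*d^2 - 8*a*b^2*c^2*d + a*b*c^4) * f1
      + (- 18*a^2*b^2*d^2 + 12*a^2*b*c^2*d - 2*a^2*c^4) * f2
      + (27*a^3*b*d^2 - 9*a^3*c^2*d - 3*a^2*b^2*c*d + a^2*b*c^3) * f3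
      + (- 27*a^4*d^2 + 2*a^3*c^3 + 2*a^2*b^3*d - a^2*b^2*c^2) * f4
      + (27*a^4*c*d - 9*a^3*b^2*d - 3*a^3*b*c^2 + a^2*b^3*c) * f5
      + (- 18*a^4*c^2 + 12*a^3*b^2*c - 2*a^2*b^4) * f6"
    by (simp add: f_defs cov_defs cdisc_def algebra_simps eval_nat_numeral)
  then show "a * v1 = b * v0"
    by (rule cancel[OF trans]) (simp add: f_zero)
  have "2 * (cdisc a b c d)^2 * (a * v2 - c * v0) =
      (- 27*a^2*c*d^3 + 18*a*b^2*d^3 + 15*a*b*c^2*d^2 - 5*a*c^4*d - 16*b^3*c*d^2 + 8*b^2*c^3*d
          - b*c^5) * f0
      + (- 27*a^2*b*d^3 + 9*a^2*c^2*d^2 + 21*a*b^2*c*d^2 - 13*a*b*c^3*d + 2*a*c^5) * f1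
      + (27*a^3*d^3 - 27*a^2*b*c*d^2 + 7*a^2*c^3*d - 2*a*b^3*d^2 + 4*a*b^2*c^2*d - a*b*c^4) * f2
      + (9*a^2*b^2*d^2 + 3*a^2*b*c^2*d - 2*a^2*c^4 - 3*a*b^3*c*d + a*b^2*c^3) * f3
      + (- 9*a^3*c^2*d - 3*a^2*b^2*c*d + 3*a^2*b*c^3 + 2*a*b^4*d - a*b^3*c^2) * f4
      + (- 27*a^4*d^2 + 27*a^3*b*c*d + 2*a^3*c^3 - 7*a^2*b^3*d - 4*a^2*b^2*c^2 + a*b^4*c) * f5
      + (27*a^4*c*d - 9*a^3*b^2*d - 21*a^3*b*c^2 + 13*a^2*b^3*c - 2*a*b^5) * f6"
    by (simp add: f_defs cov_defs cdisc_def algebra_simps eval_nat_numeral)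
  then show "a * v2 = c * v0"
    by (rule cancel[OF trans]) (simp add: f_zero)
  have "2 * (cdisc a b c d)^2 * (a * v3 - d * v0) =
      (- 27*a^2*d^4 + 27*a*b*c*d^3 - 7*a*c^3*d^2 - 16*b^3*d^3 + 8*b^2*c^2*d^2 - b*c^4*d) * f0
      + (18*a*b^2*d^3 - 12*a*b*c^2*d^2 + 2*a*c^4*d) * f1
      + (- 27*a^2*b*d^3 + 9*a^2*c^2*d^2 + 3*a*b^2*c*d^2 - a*b*c^3*d) * f2
      + (27*a^3*d^3 - 2*a^2*c^3*d - 2*a*b^3*d^2 + a*b^2*c^2*d) * f3
      + (- 27*a^3*c*d^2 + 9*a^2*b^2*d^2 + 3*a^2*b*c^2*d - a*b^3*c*d) * f4
      + (18*a^3*c^2*d - 12*a^2*b^2*c*d + 2*a*b^4*d) * f5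
      + (- 27*a^4*d^2 + 27*a^3*b*c*d - 16*a^3*c^3 - 7*a^2*b^3*d + 8*a^2*b^2*c^2 - a*b^4*c) * f6"
    by (simp add: f_defs cov_defs cdisc_def algebra_simps eval_nat_numeral)
  then show "a * v3 = d * v0"
    by (rule cancel[OF trans]) (simp add: f_zero)
  have "2 * (cdisc a b c d)^2 * (b * v2 - c * v1) =
      (27*a*b*c*d^3 - 9*a*c^3*d^2 + 18*b^3*d^3 - 33*b^2*c^2*d^2 + 15*b*c^4*d - 2*c^6) * f0
      + (- 27*a^2*c*d^3 - 27*a*b^2*d^3 + 36*a*b*c^2*d^2 - 7*a*c^4*d + 5*b^3*c*d^2 - 5*b^2*c^3*d
          + b*c^5) * f1
      + (27*a^2*b*d^3 - 9*a*b^2*c*d^2 - 5*a*b*c^3*d + 2*a*c^5 - 2*b^4*d^2 + 4*b^3*c^2*d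
          - b^2*c^4) * f2
      + (- 27*a^2*b*c*d^2 + 9*a^2*c^3*d + 9*a*b^3*d^2 + 6*a*b^2*c^2*d - 3*a*b*c^4 - 3*b^4*c*d
          + b^3*c^3) * f3
      + (27*a^3*c*d^2 - 9*a^2*b*c^2*d - 2*a^2*c^4 - 5*a*b^3*c*d + 4*a*b^2*c^3 + 2*b^5*d
          - b^4*c^2) * f4
      + (- 27*a^3*b*d^2 - 27*a^3*c^2*d + 36*a^2*b^2*c*d + 5*a^2*b*c^3 - 7*a*b^4*d - 5*a*b^3*c^2
          + b^5*c) * f5
      + (27*a^3*b*c*d + 18*a^3*c^3 - 9*a^2*b^3*d - 33*a^2*b^2*c^2 + 15*a*b^4*c - 2*b^6) * f6"
    by (simp add: f_defs cov_defs cdisc_def algebra_simps eval_nat_numeral)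
  then show "b * v2 = c * v1"
    by (rule cancel[OF trans]) (simp add: f_zero)
  have "2 * (cdisc a b c d)^2 * (b * v3 - d * v1) =
      (27*a*b*d^4 - 9*a*c^2*d^3 - 21*b^2*c*d^3 + 13*b*c^3*d^2 - 2*c^5*d) * f0
      + (- 27*a^2*d^4 + 27*a*b*c*d^3 - 7*a*c^3*d^2 + 2*b^3*d^3 - 4*b^2*c^2*d^2 + b*c^4*d) * f1
      + (- 9*a*b^2*d^3 - 3*a*b*c^2*d^2 + 2*a*c^4*d + 3*b^3*c*d^2 - b^2*c^3*d) * f2
      + (9*a^2*c^2*d^2 + 3*a*b^2*c*d^2 - 3*a*b*c^3*d - 2*b^4*d^2 + b^3*c^2*d) * f3
      + (27*a^3*d^3 - 27*a^2*b*c*d^2 - 2*a^2*c^3*d + 7*a*b^3*d^2 + 4*a*b^2*c^2*d - b^4*c*d) * f4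
      + (- 27*a^3*c*d^2 + 9*a^2*b^2*d^2 + 21*a^2*b*c^2*d - 13*a*b^3*c*d + 2*b^5*d) * f5
      + (- 27*a^3*b*d^2 + 18*a^3*c^2*d + 15*a^2*b^2*c*d - 16*a^2*b*c^3 - 5*a*b^4*d
          + 8*a*b^3*c^2 - b^5*c) * f6"
    by (simp add: f_defs cov_defs cdisc_def algebra_simps eval_nat_numeral)
  then show "b * v3 = d * v1"
    by (rule cancel[OF trans]) (simp add: f_zero)
  have "2 * (cdisc a b c d)^2 * (c * v3 - d * v2) =
      (- 18*b^2*d^4 + 12*b*c^2*d^3 - 2*c^4*d^2) * f0
      + (27*a*b*d^4 - 9*a*c^2*d^3 - 3*b^2*c*d^3 + b*c^3*d^2) * f1
      + (- 27*a^2*d^4 + 2*a*c^3*d^2 + 2*b^3*d^3 - b^2*c^2*d^2) * f2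
      + (27*a^2*c*d^3 - 9*a*b^2*d^3 - 3*a*b*c^2*d^2 + b^3*c*d^2) * f3
      + (- 18*a^2*c^2*d^2 + 12*a*b^2*c*d^2 - 2*b^4*d^2) * f4
      + (27*a^3*d^3 - 27*a^2*b*c*d^2 + 16*a^2*c^3*d + 7*a*b^3*d^2 - 8*a*b^2*c^2*d + b^4*c*d) * f5
      + (- 54*a^3*c*d^2 + 9*a^2*b^2*d^2 + 48*a^2*b*c^2*d - 16*a^2*c^4 - 20*a*b^3*c*d
          + 8*a*b^2*c^3 + 2*b^5*d - b^4*c^2) * f6"
    by (simp add: f_defs cov_defs cdisc_def algebra_simps eval_nat_numeral)
  then show "c * v3 = d * v2"
    by (rule cancel[OF trans]) (simp add: f_zero)
qed

text \<open>Vanishing 2x2 minors mean rank at most one; a nonzero discriminant supplies a nonzero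
  coefficient to divide by.\<close>

lemma cubic_syzygy_multiple:
  fixes a b c d :: "'a::field"
  assumes "cdisc a b c d \<noteq> 0"
    and "a * v1 = b * v0" "a * v2 = c * v0" "a * v3 = d * v0"
    and "b * v2 = c * v1" "b * v3 = d * v1" "c * v3 = d * v2"
  obtains l where "v0 = l * a" "v1 = l * b" "v2 = l * c" "v3 = l * d"
proof -
  have "a \<noteq> 0 \<or> b \<noteq> 0 \<or> c \<noteq> 0 \<or> d \<noteq> 0"
    using assms(1) by (auto simp: cdisc_def)
  then consider "a \<noteq> 0" | "b \<noteq> 0" | "c \<noteq> 0" | "d \<noteq> 0"
    by blast
  then show thesis
  proof cases
    case 1
    with assms that[of "v0 / a"] show thesis by (simp add: field_simps)
  next
    case 2
    with assms that[of "v1 / b"] show thesis by (simp add: field_simps)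
  next
    case 3
    with assms that[of "v2 / c"] show thesis by (simp add: field_simps)
  next
    case 4
    with assms that[of "v3 / d"] show thesis by (simp add: field_simps)
  qed
qed

text \<open>At a common zero of the form and its covariant both partial derivatives vanish, which a
  nonzero discriminant allows only at the origin.\<close>

lemma cubic_cov_no_common_zero:
  fixes a b c d x y :: "'a::idom"
  assumes two: "(2::'a) \<noteq> 0" and three: "(3::'a) \<noteq> 0" and D: "cdisc a b c d \<noteq> 0"
    and g: "cubic_at a b c d x y = 0"
    and G: "cubic_at (cov0 a b c d) (cov1 a b c d) (cov2 a b c d) (cov3 a b c d) x y = 0"
  shows "x = 0 \<and> y = 0"
proof -
  define H where "H = hess0 a b c d * x^2 + hess1 a b c d * x * y + hess2 a b c d * y^2"
  define gx where "gx = 3 * a * x^2 + 2 * b * x * y + c * y^2"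
  define gy where "gy = b * x^2 + 2 * c * x * y + 3 * d * y^2"
  have "y^2 * H = gx^2 - 3 * (3 * a * x + b * y) * cubic_at a b c d x y"
    "x^2 * H = gy^2 - 3 * (3 * d * y + c * x) * cubic_at a b c d x y"
    by (simp_all add: H_def gx_def gy_def cubic_at_def hess_defs algebra_simps eval_nat_numeral)
  then have sq: "gx^2 = y^2 * H" "gy^2 = x^2 * H"
    using g by simp_all
  have "y * cubic_at (cov0 a b c d) (cov1 a b c d) (cov2 a b c d) (cov3 a b c d) x y =
      3 * (2 * hess0 a b c d * x + hess1 a b c d * y) * cubic_at a b c d x y - 2 * (H * gx)"
    "x * cubic_at (cov0 a b c d) (cov1 a b c d) (cov2 a b c d) (cov3 a b c d) x y =
      2 * (H * gy) - 3 * (hess1 a b c d * x + 2 * hess2 a b c d * y) * cubic_at a b c d x y"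
    by (simp_all add: H_def gx_def gy_def cubic_at_def cov_defs hess_defs algebra_simps
        eval_nat_numeral)
  then have "H * gx = 0" "H * gy = 0"
    using g G two by simp_all
  \<comment> \<open>If \<open>H\<close> is nonzero it cancels from the two products; if it is zero,
    \<open>sq\<close> applies.\<close>
  then have zero: "gx = 0" "gy = 0"
    using sq by auto
  \<comment> \<open>The resultant of the two partial derivatives is
    \<open>- 3 * cdisc a b c d\<close>, so this multiple of \<open>x^3\<close> and of
    \<open>y^3\<close> lies in the ideal they generate.\<close>
  have "3 * cdisc a b c d * x^3 =
      ((15*b*c*d - 27*a*d^2 - 4*c^3) * x + (18*b*d^2 - 6*c^2*d) * y) * gx
      + ((9*a*c*d - 12*b^2*d + 3*b*c^2) * x + (2*c^3 - 6*b*c*d) * y) * gy"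
    "3 * cdisc a b c d * y^3 =
      ((2*b^3 - 6*a*b*c) * x + (9*a*b*d - 12*a*c^2 + 3*b^2*c) * y) * gx
      + ((18*a^2*c - 6*a*b^2) * x + (15*a*b*c - 27*a^2*d - 4*b^3) * y) * gy"
    by (simp_all add: gx_def gy_def cdisc_def algebra_simps eval_nat_numeral)
  then show ?thesis
    using zero three D by simp
qed

section \<open>From polynomial forms to coefficients\<close>

lemma cubic_form_pCons: "cubic_form a b c d = [:[:0, 0, 0, a:], [:0, 0, b:], [:0, c:], [:d:]:]"
  by (simp add: cubic_form_def Const_2_def Var_X_def Var_Y_def power2_eq_square power3_eq_cube)

lemma cubic_form_eq_iff:
  "cubic_form a b c d = cubic_form a' b' c' d' \<longleftrightarrow> a = a' \<and> b = b' \<and> c = c' \<and> d = d'"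
  by (auto simp: cubic_form_pCons)

lemma cubic_form_uminus: "- cubic_form a b c d = cubic_form (- a) (- b) (- c) (- d)"
  by (simp add: cubic_form_pCons)

lemma cubic_disc_cubic_form: "cubic_disc (cubic_form a b c d) = cdisc a b c d"
  by (simp add: cubic_disc_def cdisc_def cubic_form_pCons eval_nat_numeral)

lemma cubic_covariant_cubic_form:
  "cubic_covariant (cubic_form a b c d) =
     cubic_form (cov0 a b c d) (cov1 a b c d) (cov2 a b c d) (cov3 a b c d)"
proof -
  have "coeff (coeff (cubic_form a b c d) 0) 3 = a" "coeff (coeff (cubic_form a b c d) 1) 2 = b"
    "coeff (coeff (cubic_form a b c d) 2) 1 = c" "coeff (coeff (cubic_form a b c d) 3) 0 = d"
    by (simp_all add: cubic_form_pCons eval_nat_numeral)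
  then show ?thesis
    by (simp add: cubic_covariant_def cov_defs Let_def)
qed

lemma subst2_Const_4_cubic_form:
  "subst2 Const_4 (cubic_form a b c d) P Q =
     cubic_at (Const_4 a) (Const_4 b) (Const_4 c) (Const_4 d) P Q"
  by (simp add: cubic_form_pCons subst2_def map_poly_pCons Const_4_def cubic_at_def
      power2_eq_square power3_eq_cube algebra_simps)

lemma Const_2_hom:
  "Const_2 0 = 0" "Const_2 1 = 1" "Const_2 (x + y) = Const_2 x + Const_2 y"
  "Const_2 (x * y) = Const_2 x * Const_2 y" "Const_2 (x ^ n) = Const_2 x ^ n"
  "Const_2 (numeral k) = numeral k"
  by (simp_all add: Const_2_def one_pCons poly_const_pow numeral_poly)

lemma Const_4_hom:
  "Const_4 0 = 0" "Const_4 1 = 1" "Const_4 (x + y) = Const_4 x + Const_4 y"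
  "Const_4 (x * y) = Const_4 x * Const_4 y" "Const_4 (x ^ n) = Const_4 x ^ n"
  "Const_4 (numeral k) = numeral k"
  by (simp_all add: Const_4_def one_pCons poly_const_pow numeral_poly)

text \<open>This is \<open>cubic_at_tr\<close> read in \<open>K[X, Y]\<close>, with constant
  coefficients and the variables as arguments.\<close>

lemma act_cubic_form:
  fixes M :: "'a::field^2^2"
  assumes "det M = 1"
  defines "r \<equiv> M $ 1 $ 1" and "s \<equiv> M $ 1 $ 2" and "t \<equiv> M $ 2 $ 1" and "u \<equiv> M $ 2 $ 2"
  shows "act (cubic_form a b c d) M =
    cubic_form (tr0 a b c d r s t u) (tr1 a b c d r s t u) (tr2 a b c d r s t u)
      (tr3 a b c d r s t u)"
proof -
  have tr: "Const_2 (tr0 a b c d r s t u) =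
      tr0 (Const_2 a) (Const_2 b) (Const_2 c) (Const_2 d) (Const_2 r) (Const_2 s) (Const_2 t) (Const_2 u)"
    "Const_2 (tr1 a b c d r s t u) =
      tr1 (Const_2 a) (Const_2 b) (Const_2 c) (Const_2 d) (Const_2 r) (Const_2 s) (Const_2 t) (Const_2 u)"
    "Const_2 (tr2 a b c d r s t u) =
      tr2 (Const_2 a) (Const_2 b) (Const_2 c) (Const_2 d) (Const_2 r) (Const_2 s) (Const_2 t) (Const_2 u)"
    "Const_2 (tr3 a b c d r s t u) =
      tr3 (Const_2 a) (Const_2 b) (Const_2 c) (Const_2 d) (Const_2 r) (Const_2 s) (Const_2 t) (Const_2 u)"
    by (simp_all add: tr_defs Const_2_hom)
  have at: "cubic_form a b c d =
      cubic_at (Const_2 a) (Const_2 b) (Const_2 c) (Const_2 d) Var_X Var_Y" for a b c d :: 'a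
    by (simp add: cubic_form_def cubic_at_def)
  have "act (cubic_form a b c d) M =
      cubic_at (Const_2 a) (Const_2 b) (Const_2 c) (Const_2 d)
        (Const_2 r * Var_X + Const_2 t * Var_Y) (Const_2 s * Var_X + Const_2 u * Var_Y)"
    using assms(1)
    by (simp add: act_def subst2_Const_2_cubic_form cubic_at_def Const_2_hom r_def s_def t_def u_def)
  then show ?thesis
    unfolding at tr cubic_at_tr .
qed

section \<open>Evaluation of \<open>B\<close> and of bilinear forms\<close>

text \<open>
  Substituting \<open>Y1 = 1\<close>, \<open>X2 = P\<close>, \<open>Y2 = Q\<close> with \<open>P\<close>, \<open>Q\<close> in \<open>K[X1]\<close>.
\<close>

definition eval4 :: "'a::comm_ring_1 poly \<Rightarrow> 'a poly \<Rightarrow> 'a poly4 \<Rightarrow> 'a poly" where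
  "eval4 P Q p = poly (poly (poly p [:[:Q:]:]) [:P:]) 1"

lemma eval4_simps [simp]:
  "eval4 P Q (p + q) = eval4 P Q p + eval4 P Q q"
  "eval4 P Q (p - q) = eval4 P Q p - eval4 P Q q"
  "eval4 P Q (- p) = - eval4 P Q p"
  "eval4 P Q (p * q) = eval4 P Q p * eval4 P Q q"
  "eval4 P Q (p ^ n) = eval4 P Q p ^ n"
  "eval4 P Q (Const_4 c) = [:c:]"
  "eval4 P Q Var_X1 = [:0, 1:]" "eval4 P Q Var_Y1 = 1"
  "eval4 P Q Var_X2 = P" "eval4 P Q Var_Y2 = Q"
  by (simp_all add: eval4_def Const_4_def Var_X1_def Var_Y1_def Var_X2_def Var_Y2_def)

lemma cubic_at_pCons: "cubic_at [:a:] [:b:] [:c:] [:d:] [:0, 1:] 1 = [:d, c, b, a:]"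
  by (simp add: cubic_at_def eval_nat_numeral)

text \<open>At \<open>Y1 = 1\<close>, \<open>[:t, r:]\<close> and \<open>[:u, s:]\<close> are
  \<open>rX1 + tY1\<close> and \<open>sX1 + uY1\<close>. Coefficient lists ascend in degree, so
  \<open>tr3\<close> comes first.\<close>

lemma cubic_at_linear:
  "cubic_at [:a:] [:b:] [:c:] [:d:] [:t, r:] [:u, s:] =
     [:tr3 a b c d r s t u, tr2 a b c d r s t u, tr1 a b c d r s t u, tr0 a b c d r s t u:]"
  by (simp add: cubic_at_def tr_defs eval_nat_numeral algebra_simps)

lemma eval4_B_poly:
  "eval4 P Q (B_poly (cubic_form a b c d) (cubic_form a' b' c' d')) =
     cubic_at [:a':] [:b':] [:c':] [:d':] P Q
       * [:cov3 a b c d, cov2 a b c d, cov1 a b c d, cov0 a b c d:]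
     - cubic_at [:cov0 a' b' c' d':] [:cov1 a' b' c' d':] [:cov2 a' b' c' d':] [:cov3 a' b' c' d':] P Q
       * [:d, c, b, a:]"
proof -
  have "eval4 P Q (cubic_at k l m n x y) = cubic_at (eval4 P Q k) (eval4 P Q l) (eval4 P Q m)
      (eval4 P Q n) (eval4 P Q x) (eval4 P Q y)" for k l m n x y
    by (simp add: cubic_at_def)
  then show ?thesis
    by (simp add: B_poly_def cubic_covariant_cubic_form subst2_Const_4_cubic_form cubic_at_pCons)
qed

lemma eval4_bilinear_of:
  "eval4 P Q (bilinear_of M) =
     [:M $ 2 $ 1, M $ 1 $ 1:] * Q - [:M $ 2 $ 2, M $ 1 $ 2:] * P"
  by (simp add: bilinear_of_def algebra_simps)

lemma eval4_dvd_eq_zero: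
  assumes "p dvd q" "eval4 P Q p = 0"
  shows "eval4 P Q q = 0"
  using assms by (auto elim!: dvdE)

lemma bilinear_of_pCons:
  "bilinear_of M =
     [:[:0, [:[:0, - M $ 1 $ 2:], [:- M $ 2 $ 2:]:]:], [:[:[:0, M $ 1 $ 1:], [:M $ 2 $ 1:]:]:]:]"
  by (simp add: bilinear_of_def Const_4_def Var_X1_def Var_Y1_def Var_X2_def Var_Y2_def)

lemma bihomogeneous_1_1_bilinear_of:
  fixes p :: "'a::comm_ring_1 poly4"
  assumes "bihomogeneous 1 1 p"
  obtains M where "p = bilinear_of M"
proof -
  \<comment> \<open>From the outside in, the indices are the exponents of \<open>Y2\<close>,
    \<open>X2\<close>, \<open>Y1\<close>, \<open>X1\<close>; the minus signs undo those in
    \<open>bilinear_of\<close>.\<close>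
  define M :: "'a^2^2" where "M = vector
    [vector [coeff (coeff (coeff (coeff p 1) 0) 0) 1, - coeff (coeff (coeff (coeff p 0) 1) 0) 1],
     vector [coeff (coeff (coeff (coeff p 1) 0) 1) 0, - coeff (coeff (coeff (coeff p 0) 1) 1) 0]]"
  have M: "M $ 1 $ 1 = coeff (coeff (coeff (coeff p 1) 0) 0) 1"
    "M $ 1 $ 2 = - coeff (coeff (coeff (coeff p 0) 1) 0) 1"
    "M $ 2 $ 1 = coeff (coeff (coeff (coeff p 1) 0) 1) 0"
    "M $ 2 $ 2 = - coeff (coeff (coeff (coeff p 0) 1) 1) 0"
    by (simp_all add: M_def)
  have zero: "coeff (coeff (coeff (coeff p l) k) j) i = 0" if "i + j \<noteq> 1 \<or> k + l \<noteq> 1" for i j k l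
    using assms that unfolding bihomogeneous_def by blast
  have "coeff (coeff (coeff (coeff p l) k) j) i =
      coeff (coeff (coeff (coeff (bilinear_of M) l) k) j) i" for i j k l
  proof (cases "i + j = 1 \<and> k + l = 1")
    case True
    then have "(i = 0 \<and> j = 1 \<or> i = 1 \<and> j = 0) \<and> (k = 0 \<and> l = 1 \<or> k = 1 \<and> l = 0)"
      by auto
    then show ?thesis
      by (auto simp: bilinear_of_pCons M)
  next
    case False
    then show ?thesis
      by (subst zero) (auto simp: bilinear_of_pCons coeff_pCons split: nat.splits)
  qed
  then show thesis
    by (intro that[of M] poly_eqI)
qed

text \<open>The coefficients of degrees 6 down to 0, in the shape expected by
  \<open>cubic_syzygies_proportional\<close>.\<close>

lemma cubic_pCons_mult_eqD:
  fixes h0 h1 h2 h3 :: "'a::comm_ring_1"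
  assumes "[:h3, h2, h1, h0:] * [:u3, u2, u1, u0:] = [:k3, k2, k1, k0:] * [:v3, v2, v1, v0:]"
  shows "h0 * u0 = k0 * v0" "h0 * u1 + h1 * u0 = k0 * v1 + k1 * v0"
    and "h0 * u2 + h1 * u1 + h2 * u0 = k0 * v2 + k1 * v1 + k2 * v0"
    and "h0 * u3 + h1 * u2 + h2 * u1 + h3 * u0 = k0 * v3 + k1 * v2 + k2 * v1 + k3 * v0"
    and "h1 * u3 + h2 * u2 + h3 * u1 = k1 * v3 + k2 * v2 + k3 * v1"
    and "h2 * u3 + h3 * u2 = k2 * v3 + k3 * v2" "h3 * u3 = k3 * v3"
proof -
  have eq: "coeff ([:h3, h2, h1, h0:] * [:u3, u2, u1, u0:]) n =
      coeff ([:k3, k2, k1, k0:] * [:v3, v2, v1, v0:]) n" for n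
    by (simp only: assms)
  note simps = coeff_mult atMost_Suc eval_nat_numeral
  show "h0 * u0 = k0 * v0"
    using eq[of 6] by (simp add: simps ac_simps)
  show "h0 * u1 + h1 * u0 = k0 * v1 + k1 * v0"
    using eq[of 5] by (simp add: simps ac_simps)
  show "h0 * u2 + h1 * u1 + h2 * u0 = k0 * v2 + k1 * v1 + k2 * v0"
    using eq[of 4] by (simp add: simps ac_simps)
  show "h0 * u3 + h1 * u2 + h2 * u1 + h3 * u0 = k0 * v3 + k1 * v2 + k2 * v1 + k3 * v0"
    using eq[of 3] by (simp add: simps ac_simps)
  show "h1 * u3 + h2 * u2 + h3 * u1 = k1 * v3 + k2 * v2 + k3 * v1"
    using eq[of 2] by (simp add: simps ac_simps)
  show "h2 * u3 + h3 * u2 = k2 * v3 + k3 * v2"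
    using eq[of 1] by (simp add: simps ac_simps)
  show "h3 * u3 = k3 * v3"
    using eq[of 0] by (simp add: simps ac_simps)
qed

section \<open>From a bilinear factor to a linear substitution\<close>

text \<open>The determinant is kept general: an arbitrary factor is rescaled afterwards, while
  determinant 1 leaves only \<open>l = 1\<close> and \<open>l = - 1\<close>.\<close>

lemma bilinear_factor_imp_multiple:
  fixes a b c d a' b' c' d' :: "'a::field" and M :: "'a^2^2"
  assumes two: "(2::'a) \<noteq> 0" and three: "(3::'a) \<noteq> 0"
    and D: "cdisc a b c d \<noteq> 0" and D': "cdisc a' b' c' d' \<noteq> 0"
    and dvd: "bilinear_of M dvd B_poly (cubic_form a b c d) (cubic_form a' b' c' d')"
    and det: "det M \<noteq> 0"
  defines "r \<equiv> M $ 1 $ 1" and "s \<equiv> M $ 1 $ 2" and "t \<equiv> M $ 2 $ 1" and "u \<equiv> M $ 2 $ 2"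
  obtains l where "a = l * tr0 a' b' c' d' r s t u" "b = l * tr1 a' b' c' d' r s t u"
    "c = l * tr2 a' b' c' d' r s t u" "d = l * tr3 a' b' c' d' r s t u"
    "l^2 * (det M)^3 = 1"
proof -
  define e where "e = r * u - s * t"
  have e: "det M = e"
    by (simp add: det_2 e_def r_def s_def t_def u_def)
  define h0 where "h0 = tr0 a' b' c' d' r s t u"
  define h1 where "h1 = tr1 a' b' c' d' r s t u"
  define h2 where "h2 = tr2 a' b' c' d' r s t u"
  define h3 where "h3 = tr3 a' b' c' d' r s t u"
  note h_defs = h0_def h1_def h2_def h3_def
  define h where "h = [:h3, h2, h1, h0:]"
  define H where "H = [:cov3 h0 h1 h2 h3, cov2 h0 h1 h2 h3, cov1 h0 h1 h2 h3, cov0 h0 h1 h2 h3:]"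
  define G where "G = [:cov3 a b c d, cov2 a b c d, cov1 a b c d, cov0 a b c d:]"
  have "cdisc h0 h1 h2 h3 = e^6 * cdisc a' b' c' d'"
    unfolding h_defs e_def by (rule cdisc_tr[OF three])
  then have Dh: "cdisc h0 h1 h2 h3 \<noteq> 0"
    using D' det e by simp
  have H_eq: "H = smult (e^3) (cubic_at [:cov0 a' b' c' d':] [:cov1 a' b' c' d':]
      [:cov2 a' b' c' d':] [:cov3 a' b' c' d':] [:t, r:] [:u, s:])"
    by (simp add: H_def h_defs cov_tr cubic_at_linear e_def)
  have "eval4 [:t, r:] [:u, s:] (bilinear_of M) = 0"
    unfolding eval4_bilinear_of r_def s_def t_def u_def by (simp add: mult.commute)
  then have "eval4 [:t, r:] [:u, s:] (B_poly (cubic_form a b c d) (cubic_form a' b' c' d')) = 0"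
    by (rule eval4_dvd_eq_zero[OF dvd])
  then have "h * G = cubic_at [:cov0 a' b' c' d':] [:cov1 a' b' c' d':]
      [:cov2 a' b' c' d':] [:cov3 a' b' c' d':] [:t, r:] [:u, s:] * [:d, c, b, a:]"
    by (simp add: eval4_B_poly h_def h_defs cubic_at_linear G_def del: mult_pCons_left mult_pCons_right)
  then have key: "h * smult (e^3) G = H * [:d, c, b, a:]"
    by (simp only: H_eq mult_smult_left mult_smult_right)
  then have "[:h3, h2, h1, h0:] * [:e^3 * cov3 a b c d, e^3 * cov2 a b c d, e^3 * cov1 a b c d,
      e^3 * cov0 a b c d:] = [:cov3 h0 h1 h2 h3, cov2 h0 h1 h2 h3, cov1 h0 h1 h2 h3,
      cov0 h0 h1 h2 h3:] * [:d, c, b, a:]"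
    by (simp add: h_def G_def H_def del: mult_pCons_left mult_pCons_right)
  note eqs = cubic_pCons_mult_eqD[OF this]
  \<comment> \<open>Since \<open>h\<close> and its covariant \<open>H\<close> are coprime,
    \<open>key\<close> forces \<open>g1\<close> to be a multiple of \<open>h\<close>.\<close>
  obtain l where l: "a = l * h0" "b = l * h1" "c = l * h2" "d = l * h3"
    by (rule cubic_syzygy_multiple[OF Dh cubic_syzygies_proportional[OF two Dh eqs]])
  have "l \<noteq> 0"
    using D by (auto simp: l cdisc_def)
  \<comment> \<open>The covariant is cubic in the coefficients, so \<open>key\<close> now compares
    \<open>e^3 * l^3\<close> with \<open>l\<close> as multiples of \<open>h * H\<close>.\<close>
  have "G = smult (l^3) H" "[:d, c, b, a:] = smult l h"
    by (simp_all add: G_def H_def h_def l cov_scale)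
  with key have "smult (e^3 * l^3 - l) (h * H) = 0"
    by (simp add: smult_diff_left mult.commute del: mult_pCons_left mult_pCons_right)
  moreover have "h \<noteq> 0"
    using Dh by (auto simp: h_def cdisc_def)
  moreover have "H \<noteq> 0"
    using Dh cdisc_zero_if_cov_proportional[OF two three, of 1 h0 h1 h2 h3 0] by (auto simp: H_def)
  ultimately have "l * (l^2 * e^3) = l * 1"
    by (simp add: power2_eq_square power3_eq_cube mult_ac)
  with \<open>l \<noteq> 0\<close> have "l^2 * (det M)^3 = 1"
    unfolding e mult_cancel_left by blast
  with l show thesis
    by (intro that) (simp_all add: h_defs)
qed

lemma bilinear_factor_det_nonzero:
  fixes a b c d a' b' c' d' :: "'a::field" and M :: "'a^2^2"
  assumes two: "(2::'a) \<noteq> 0" and three: "(3::'a) \<noteq> 0"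
    and D: "cdisc a b c d \<noteq> 0" and D': "cdisc a' b' c' d' \<noteq> 0"
    and dvd: "bilinear_of M dvd B_poly (cubic_form a b c d) (cubic_form a' b' c' d')"
    and nz: "bilinear_of M \<noteq> 0"
  shows "det M \<noteq> 0"
proof
  assume det: "det M = 0"
  have "\<not> (M $ 1 $ 1 = 0 \<and> M $ 1 $ 2 = 0) \<or> \<not> (M $ 2 $ 1 = 0 \<and> M $ 2 $ 2 = 0)"
    using nz by (auto simp: bilinear_of_pCons)
  \<comment> \<open>Both rows of a singular matrix are proportional to a nonzero row
    \<open>(x, y)\<close>, so the bilinear form vanishes at \<open>(X2, Y2) = (x, y)\<close> for
    every \<open>(X1, Y1)\<close>.\<close>
  then obtain i where row: "\<not> (M $ i $ 1 = 0 \<and> M $ i $ 2 = 0)"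
    by blast
  define x where "x = M $ i $ 1"
  define y where "y = M $ i $ 2"
  define p where "p = cubic_at a' b' c' d' x y"
  define q where "q = cubic_at (cov0 a' b' c' d') (cov1 a' b' c' d') (cov2 a' b' c' d')
    (cov3 a' b' c' d') x y"
  have "i = 1 \<or> i = 2"
    by (rule exhaust_2)
  then have "M $ 2 $ 1 * y = M $ 2 $ 2 * x" "M $ 1 $ 1 * y = M $ 1 $ 2 * x"
    using det by (auto simp: x_def y_def det_2 algebra_simps)
  then have "eval4 [:x:] [:y:] (bilinear_of M) = 0"
    by (simp add: eval4_bilinear_of mult.commute)
  then have "eval4 [:x:] [:y:] (B_poly (cubic_form a b c d) (cubic_form a' b' c' d')) = 0"
    by (rule eval4_dvd_eq_zero[OF dvd])
  moreover have "cubic_at [:k:] [:l:] [:m:] [:n:] [:x:] [:y:] = [:cubic_at k l m n x y:]" for k l m n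
    by (simp add: cubic_at_def eval_nat_numeral algebra_simps)
  ultimately have eqs: "p * cov0 a b c d = q * a" "p * cov1 a b c d = q * b"
    "p * cov2 a b c d = q * c" "p * cov3 a b c d = q * d"
    by (simp_all add: eval4_B_poly p_def q_def mult.commute)
  \<comment> \<open>Otherwise the covariant of the first cubic would be a multiple of that cubic.
    Then \<open>q\<close> vanishes too, and \<open>(x, y)\<close> is a forbidden common zero for the
    second cubic.\<close>
  then have "p = 0"
    using cdisc_zero_if_cov_proportional[OF two three eqs] D by blast
  moreover have "a \<noteq> 0 \<or> b \<noteq> 0 \<or> c \<noteq> 0 \<or> d \<noteq> 0"
    using D by (auto simp: cdisc_def)
  ultimately have "q = 0"
    using eqs by auto
  with \<open>p = 0\<close> have "x = 0 \<and> y = 0"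
    unfolding p_def q_def by (intro cubic_cov_no_common_zero[OF two three D'])
  with row show False
    by (simp add: x_def y_def)
qed

section \<open>From a substitution to a bilinear factor\<close>

text \<open>Grouping by 2x2 minors of the coefficients leaves antisymmetric differences of
  monomials, each divisible by \<open>p * y - q * x\<close>; the witness collects the
  quotients.\<close>

lemma cubic_pencil_antisymmetric_dvd:
  fixes x y p q :: "'a::comm_ring_1"
  shows "p * y - q * x dvd
    cubic_at a b c d x y * cubic_at a' b' c' d' p q - cubic_at a' b' c' d' x y * cubic_at a b c d p q"
proof
  show "cubic_at a b c d x y * cubic_at a' b' c' d' p q
      - cubic_at a' b' c' d' x y * cubic_at a b c d p q =
    (p * y - q * x) * - ((a * b' - b * a') * x^2 * p^2 + (b * c' - c * b') * x * y * p * q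
      + (c * d' - d * c') * y^2 * q^2 + (a * c' - c * a') * x * p * (x * q + y * p)
      + (b * d' - d * b') * y * q * (x * q + y * p)
      + (a * d' - d * a') * ((x * q)^2 + x * q * y * p + (y * p)^2))"
    by (simp add: cubic_at_def algebra_simps eval_nat_numeral)
qed

lemma act_imp_bilinear_factor:
  fixes g :: "'a::field poly2"
  assumes "binary_cubic_form g" and det: "det M = 1"
  shows "bilinear_of M dvd B_poly (act g M) g"
proof -
  obtain a b c d where g: "g = cubic_form a b c d"
    using assms(1) by (auto simp: binary_cubic_form_def)
  define r s t u where "r = M $ 1 $ 1" and "s = M $ 1 $ 2" and "t = M $ 2 $ 1" and "u = M $ 2 $ 2"
  note M = r_def s_def t_def u_def
  have e: "r * u - s * t = 1"
    using det by (simp add: det_2 M)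
  have tr: "cubic_at (Const_4 (tr0 a b c d r s t u)) (Const_4 (tr1 a b c d r s t u))
      (Const_4 (tr2 a b c d r s t u)) (Const_4 (tr3 a b c d r s t u)) Var_X1 Var_Y1 =
      cubic_at (Const_4 a) (Const_4 b) (Const_4 c) (Const_4 d)
        (Const_4 r * Var_X1 + Const_4 t * Var_Y1) (Const_4 s * Var_X1 + Const_4 u * Var_Y1)"
    for a b c d
    unfolding cubic_at_tr[symmetric] by (simp add: tr_defs Const_4_hom)
  have L: "bilinear_of M = (Const_4 r * Var_X1 + Const_4 t * Var_Y1) * Var_Y2
      - (Const_4 s * Var_X1 + Const_4 u * Var_Y1) * Var_X2"
    by (simp add: bilinear_of_def M algebra_simps)
  show ?thesis
    unfolding g act_cubic_form[OF det] L B_poly_def cubic_covariant_cubic_form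
      subst2_Const_4_cubic_form
    \<comment> \<open>For determinant 1 the covariant of the transformed form is the transformed
      covariant, so \<open>tr\<close> turns both into values at the same point.\<close>
    unfolding M[symmetric] cov_tr e power_one mult_1_left tr
    by (rule cubic_pencil_antisymmetric_dvd)
qed

section \<open>Symmetry of equivalence and the final assembly\<close>

text \<open>The definition transforms \<open>g1\<close> into \<open>g2\<close>, whereas bilinear
  factors yield the opposite direction; the adjugate matrix reverses it.\<close>

lemma SL2_equivalent_iff_act:
  fixes g1 g2 :: "'a::field poly2"
  assumes "binary_cubic_form g1" "binary_cubic_form g2"
  shows "SL2_equivalent g1 g2 \<longleftrightarrow> (\<exists>M. det M = 1 \<and> g1 = act g2 M)"
proof -
  have "\<exists>N. det N = 1 \<and> g = act (act g M) N"
    if g: "binary_cubic_form g" and M: "det M = 1" for g :: "'a poly2" and M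
  proof -
    obtain a b c d where g: "g = cubic_form a b c d"
      using g by (auto simp: binary_cubic_form_def)
    define N :: "'a^2^2" where "N = vector [vector [M $ 2 $ 2, - M $ 1 $ 2], vector [- M $ 2 $ 1, M $ 1 $ 1]]"
    have N: "N $ 1 $ 1 = M $ 2 $ 2" "N $ 1 $ 2 = - M $ 1 $ 2"
      "N $ 2 $ 1 = - M $ 2 $ 1" "N $ 2 $ 2 = M $ 1 $ 1"
      by (simp_all add: N_def)
    have det: "M $ 1 $ 1 * M $ 2 $ 2 - M $ 1 $ 2 * M $ 2 $ 1 = 1"
      using M by (simp add: det_2)
    then have "det N = 1"
      by (simp add: det_2 N mult.commute)
    then show ?thesis
      using M by (intro exI[of _ N]) (simp add: g act_cubic_form N tr_adjugate[OF det])
  qed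
  then show ?thesis
    using assms unfolding SL2_equivalent_def by metis
qed

theorem theorem1p2:
  fixes g1 g2 :: "'a::field poly poly"
  assumes "CHAR('a) \<noteq> 2" and "CHAR('a) \<noteq> 3"
    and "binary_cubic_form g1" and "binary_cubic_form g2"
    and "cubic_disc g1 = cubic_disc g2" and "cubic_disc g2 \<noteq> 0"
  shows "(has_bilinear_factor (B_poly g1 g2) \<longleftrightarrow> SL2_equivalent g1 g2) \<and>
    (\<forall>M :: 'a^2^2. det M = 1 \<longrightarrow>
       ((\<exists>c. c \<noteq> 0 \<and> Const_4 c * bilinear_of M dvd B_poly g1 g2) \<longleftrightarrow>
        (g1 = act g2 M \<or> g1 = act g2 (- M))))"
proof -
  have prime_nonzero: "of_nat p \<noteq> (0::'a)" if "prime p" "CHAR('a) \<noteq> p" for p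
  proof
    assume "of_nat p = (0::'a)"
    then have "CHAR('a) dvd p"
      by (simp add: of_nat_eq_0_iff_char_dvd)
    with that show False
      by (auto simp: prime_nat_iff)
  qed
  have two: "(2::'a) \<noteq> 0"
    using prime_nonzero[of 2] assms(1) by simp
  have three: "(3::'a) \<noteq> 0"
    using prime_nonzero[of 3] assms(2) by simp
  obtain a b c d where g1: "g1 = cubic_form a b c d"
    using assms(3) by (auto simp: binary_cubic_form_def)
  obtain a' b' c' d' where g2: "g2 = cubic_form a' b' c' d'"
    using assms(4) by (auto simp: binary_cubic_form_def)
  have D': "cdisc a' b' c' d' \<noteq> 0" and D: "cdisc a b c d \<noteq> 0"
    using assms(5,6) by (simp_all add: g1 g2 cubic_disc_cubic_form)
  note multiple = bilinear_factor_imp_multiple[OF two three D D', folded g1 g2]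

  have "\<exists>M. det M = 1 \<and> g1 = act g2 M" if factor: "has_bilinear_factor (B_poly g1 g2)"
  proof -
    obtain N where N: "bilinear_of N \<noteq> 0" "bilinear_of N dvd B_poly g1 g2"
      using factor unfolding has_bilinear_factor_def by (metis bihomogeneous_1_1_bilinear_of)
    have "det N \<noteq> 0"
      using bilinear_factor_det_nonzero[OF two three D D'] N by (simp add: g1 g2)
    then obtain l where l: "a = l * tr0 a' b' c' d' (N $ 1 $ 1) (N $ 1 $ 2) (N $ 2 $ 1) (N $ 2 $ 2)"
      "b = l * tr1 a' b' c' d' (N $ 1 $ 1) (N $ 1 $ 2) (N $ 2 $ 1) (N $ 2 $ 2)"
      "c = l * tr2 a' b' c' d' (N $ 1 $ 1) (N $ 1 $ 2) (N $ 2 $ 1) (N $ 2 $ 2)"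
      "d = l * tr3 a' b' c' d' (N $ 1 $ 1) (N $ 1 $ 2) (N $ 2 $ 1) (N $ 2 $ 2)"
      and sq: "l^2 * (det N)^3 = 1"
      using multiple[OF N(2)] by metis
    \<comment> \<open>The determinant of \<open>N\<close> is the square of \<open>1 / (l * det N)\<close>, so \<open>N\<close> rescales into \<open>SL2\<close>.\<close>
    define M where "M = (\<chi> i j. l * det N * N $ i $ j)"
    have "det M = (l * det N)^2 * det N"
      by (simp add: M_def det_2 algebra_simps power2_eq_square)
    also have "\<dots> = 1"
      using sq by (simp add: power2_eq_square power3_eq_cube mult_ac)
    finally have det: "det M = 1" .
    \<comment> \<open>Scaling a matrix by \<open>l * det N\<close> scales the transformed cubic by
      its cube, which is exactly the missing factor \<open>l\<close>.\<close>
    have "(l * det N)^3 = l * (l^2 * (det N)^3)"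
      by (simp add: power2_eq_square power3_eq_cube mult_ac)
    then have "(l * det N)^3 = l"
      by (simp add: sq)
    then have "act g2 M = g1"
      unfolding g1 g2 act_cubic_form[OF det] cubic_form_eq_iff
      by (simp add: M_def tr_scale l[symmetric])
    with det show ?thesis
      by blast
  qed
  moreover have "has_bilinear_factor (B_poly g1 g2)" if "det M = 1" "g1 = act g2 M" for M
  proof -
    have "bilinear_of M \<noteq> 0"
      using that(1) by (auto simp: bilinear_of_pCons det_2)
    moreover have "bihomogeneous 1 1 (bilinear_of M)"
      by (auto simp: bihomogeneous_def bilinear_of_pCons coeff_pCons split: nat.splits)
    ultimately show ?thesis
      using act_imp_bilinear_factor[OF assms(4) that(1)] that(2)
      unfolding has_bilinear_factor_def by blast
  qed
  moreover have "g1 = act g2 M \<or> g1 = act g2 (- M)"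
    if det: "det M = 1" and dvd: "Const_4 k * bilinear_of M dvd B_poly g1 g2" for M k
  proof -
    have "bilinear_of M dvd B_poly g1 g2"
      using dvd by (rule dvd_mult_right)
    then obtain l where l: "a = l * tr0 a' b' c' d' (M $ 1 $ 1) (M $ 1 $ 2) (M $ 2 $ 1) (M $ 2 $ 2)"
      "b = l * tr1 a' b' c' d' (M $ 1 $ 1) (M $ 1 $ 2) (M $ 2 $ 1) (M $ 2 $ 2)"
      "c = l * tr2 a' b' c' d' (M $ 1 $ 1) (M $ 1 $ 2) (M $ 2 $ 1) (M $ 2 $ 2)"
      "d = l * tr3 a' b' c' d' (M $ 1 $ 1) (M $ 1 $ 2) (M $ 2 $ 1) (M $ 2 $ 2)"
      and "l^2 * (det M)^3 = 1"
      using multiple det by (metis zero_neq_one)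
    \<comment> \<open>The sign ambiguity arises here: \<open>l = - 1\<close> corresponds to the
      action of \<open>- M\<close>.\<close>
    then have "l = 1 \<or> l = - 1"
      by (simp add: det power2_eq_1_iff)
    moreover have "g1 = act g2 M" if "l = 1"
      by (simp add: that g1 g2 act_cubic_form[OF det] l)
    moreover have "g1 = - act g2 M" if "l = - 1"
      by (simp add: that g1 g2 act_cubic_form[OF det] cubic_form_uminus l)
    ultimately show ?thesis
      using act_uminus[OF assms(4)] by auto
  qed
  moreover have "Const_4 1 * bilinear_of M dvd B_poly g1 g2"
    if det: "det M = 1" and "g1 = act g2 M \<or> g1 = act g2 (- M)" for M
    using that(2)
  proof
    assume "g1 = act g2 M"
    then show ?thesis
      using act_imp_bilinear_factor[OF assms(4) det] by (simp add: Const_4_hom)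
  next
    assume "g1 = act g2 (- M)"
    \<comment> \<open>The bilinear forms of \<open>M\<close> and \<open>- M\<close> differ by a
      unit, so they divide the same polynomials.\<close>
    moreover have "det (- M) = 1"
      using det by (simp add: det_2)
    ultimately show ?thesis
      using act_imp_bilinear_factor[OF assms(4), of "- M"]
      by (simp add: Const_4_hom bilinear_of_uminus)
  qed
  ultimately show ?thesis
    unfolding SL2_equivalent_iff_act[OF assms(3,4)] by (metis zero_neq_one)
qed

end
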